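(* For $k\in\mathbb Z$, let $P_k=\frac{k(3k-1)}{2}$, and for any integer $n\ge 0$ define $$\rho(n)=\#\left\{(a,j)\in\mathbb Z_{>0}\times\mathbb Z: n=2a^2+24j^2+10j+1\right\}+\#\left\{(a,j)\in\mathbb Z_{>0}\times\mathbb Z: n=2a^2+24j^2+22j+5\right\},$$ where $\#S$ denotes the number of elements of the finite set $S$. Then, for every integer $n\ge 0$, $$DSOME(n)\equiv \begin{cases} 2\rho(n)-(-1)^k n\pmod 4, & \text{if } n=P_k\text{ for some unique }k\in\mathbb Z,\\ 2\rho(n)\pmod 4, & \text{if } n\neq P_k\text{ for every }k\in\mathbb Z. \end{cases}$$
   Context: $DSOME(n)$ denotes the sum of all the odd parts in all the partitions of $n$ into distinct parts minus the sum of all the even parts in all those same partitions, with $DSOME(0)=0$. Equivalently, $\sum_{n\ge 0}DSOME(n)q^n=\prod_{j\ge1}(1+q^j)\cdot\sum_{m\ge 1}\frac{(-1)^{m-1}q^m}{(1+q^m)^2}$. *)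

theory Defs
  imports "HOL-Number_Theory.Cong"
begin

(* A partition into distinct parts is determined by its set of parts. *)
definition distinct_partitions :: "nat \<Rightarrow> nat set set" where
  "distinct_partitions n = {S. finite S \<and> 0 \<notin> S \<and> \<Sum>S = n}"

lemma finite_distinct_partitions: "finite (distinct_partitions n)"
proof -
  have "p \<le> n" if "finite S" "\<Sum>S = n" "p \<in> S" for S and p :: nat
    using that member_le_sum[of p S "\<lambda>x. x"] by auto
  then have "distinct_partitions n \<subseteq> Pow {..n}"
    unfolding distinct_partitions_def by blast
  then show ?thesis
    by (rule finite_subset) simp
qed

definition DSOME :: "nat \<Rightarrow> int" where
  "DSOME n = (\<Sum>S \<in> distinct_partitions n. \<Sum>p \<in> {p \<in> S. odd p}. int p)
           - (\<Sum>S \<in> distinct_partitions n. \<Sum>p \<in> {p \<in> S. even p}. int p)"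

definition pentagonal :: "int \<Rightarrow> int" where
  "pentagonal k = k * (3 * k - 1) div 2"

(* The division in the definition is exact. *)
lemma two_times_pentagonal: "2 * pentagonal k = k * (3 * k - 1)"
  unfolding pentagonal_def by (rule dvd_mult_div_cancel) simp

definition rho_set1 :: "nat \<Rightarrow> (int \<times> int) set" where
  "rho_set1 n = {(a, j). a > 0 \<and> int n = 2 * a^2 + 24 * j^2 + 10 * j + 1}"

definition rho_set2 :: "nat \<Rightarrow> (int \<times> int) set" where
  "rho_set2 n = {(a, j). a > 0 \<and> int n = 2 * a^2 + 24 * j^2 + 22 * j + 5}"

lemma finite_rho_aux:
  fixes b c :: int
  assumes "\<bar>b\<bar> \<le> 23" "c \<ge> 0"
  shows "finite {(a, j). a > 0 \<and> int n = 2 * a^2 + 24 * j^2 + b * j + c}"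
proof (rule finite_subset)
  show "{(a, j). a > 0 \<and> int n = 2 * a^2 + 24 * j^2 + b * j + c}
      \<subseteq> {0..int n} \<times> {- int n..int n}"
  proof safe
    fix a j :: int
    assume a: "a > 0" and eq: "int n = 2 * a^2 + 24 * j^2 + b * j + c"
    have sq: "\<bar>x\<bar> \<le> x^2" for x :: int
      by (cases "x = 0") (use self_le_power[of "\<bar>x\<bar>" 2] in auto)
    have "\<bar>b * j\<bar> \<le> 23 * \<bar>j\<bar>"
      using assms(1) by (simp add: abs_mult mult_right_mono)
    then have "\<bar>a\<bar> \<le> int n" "\<bar>j\<bar> \<le> int n"
      using sq[of a] sq[of j] eq assms(2) by linarith+
    then show "a \<in> {0..int n}" "j \<in> {- int n..int n}"
      using a by auto
  qed
qed simp

lemma finite_rho_set1: "finite (rho_set1 n)"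
  unfolding rho_set1_def by (rule finite_rho_aux) auto

lemma finite_rho_set2: "finite (rho_set2 n)"
  unfolding rho_set2_def by (rule finite_rho_aux) auto

definition rho :: "nat \<Rightarrow> nat" where
  "rho n = card (rho_set1 n) + card (rho_set2 n)"

end

theory Submission
  imports Defs "HOL-Computational_Algebra.Formal_Power_Series"
begin

text \<open>
  Write \<open>P = \<Prod>(1 - q^j)\<close>, \<open>Q = \<Prod>(1 + q^j)\<close>, \<open>T = \<Sum>a\<ge>1. q^(a^2)\<close>, let \<open>\<theta> = q d/dq\<close>
  and let \<open>V\<close> be the substitution of \<open>q^2\<close> for \<open>q\<close>.

  An odd part counts with sign plus, and an even part \<open>p\<close> satisfies \<open>-p \<equiv> p\<close> modulo 4. Hence each
  partition of \<open>n\<close> into distinct parts contributes \<open>n\<close> modulo 4, and \<open>DSOME n\<close> is congruent to \<open>n\<close>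
  times the coefficient of \<open>q^n\<close> in \<open>Q\<close> (\<open>DSOME_cong_card\<close>). Since
  \<open>1 + q^j = (1 - q^j)(1 + 2 q^j/(1 - q^j))\<close>, modulo 4 only the terms linear in
  \<open>q^j/(1 - q^j)\<close> survive in \<open>Q/P\<close>. Their sum is the generating function of the number of
  divisors, which is odd exactly at squares, so \<open>Q \<equiv> P(1 + 2T)\<close> modulo 4
  (\<open>distinct_product_cong\<close>).

  The generating function of \<open>n\<close> times the coefficient is therefore
  \<open>\<theta>Q \<equiv> -\<theta>P + 2(\<theta>P + \<theta>(PT))\<close> modulo 4. The first summand is the pentagonal term, by Euler's
  pentagonal number theorem. The bracket is needed only modulo 2. There the logarithmic
  derivative of \<open>P\<close> is the generating function of the sum of divisors, which is odd exactly
  at squares and doubles of squares, so \<open>\<theta>P \<equiv> P(T + VT)\<close>; moreover \<open>\<theta>T\<close> keeps the odd squares,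
  so \<open>\<theta>T \<equiv> T + VVT\<close>, and \<open>f^2 \<equiv> Vf\<close> for every series \<open>f\<close>. These three facts collapse the bracket
  to \<open>VT \<cdot> \<theta>P\<close> (\<open>theta_euler_squares\<close>). Modulo 2 that product counts the ways to write \<open>n\<close> as
  \<open>2a^2\<close> plus an odd pentagonal number; the pentagonal number of index \<open>k\<close> is odd exactly when
  \<open>k\<close> is 1 or 2 modulo 4, and these two classes give the two quadratic forms in \<open>rho\<close>
  (\<open>correction_cong_rho\<close>).

  All infinite products and sums are cut off at some \<open>N\<close>, and congruences are only asserted for
  the coefficients up to \<open>N\<close>; this relation is still compatible with sums and products.
\<close>

unbundle fps_syntax

section \<open>Truncated congruences of integer power series\<close>

definition fps_cong :: "nat \<Rightarrow> int \<Rightarrow> int fps \<Rightarrow> int fps \<Rightarrow> bool" where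
  "fps_cong N m f g \<longleftrightarrow> (\<forall>i\<le>N. [f $ i = g $ i] (mod m))"

lemma fps_cong_refl [simp]: "fps_cong N m f f"
  by (simp add: fps_cong_def)

lemma fps_cong_sym: "fps_cong N m f g \<Longrightarrow> fps_cong N m g f"
  by (auto simp: fps_cong_def intro: cong_sym)

lemma fps_cong_trans [trans]:
  "fps_cong N m f g \<Longrightarrow> fps_cong N m g h \<Longrightarrow> fps_cong N m f h"
  by (auto simp: fps_cong_def intro: cong_trans)

lemma fps_cong_add:
  "fps_cong N m f g \<Longrightarrow> fps_cong N m f' g' \<Longrightarrow> fps_cong N m (f + f') (g + g')"
  by (auto simp: fps_cong_def intro: cong_add)

lemma fps_cong_mult:
  assumes "fps_cong N m f g" "fps_cong N m f' g'"
  shows "fps_cong N m (f * f') (g * g')"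
  unfolding fps_cong_def
proof (intro allI impI)
  fix i assume "i \<le> N"
  then show "[(f * f') $ i = (g * g') $ i] (mod m)"
    using assms unfolding fps_mult_nth fps_cong_def by (intro cong_sum cong_mult) auto
qed

lemma fps_cong_add_multiple: "fps_cong N m (f + of_int m * g) f"
  by (simp add: fps_cong_def cong_iff_dvd_diff flip: fps_of_int)

text \<open>
  Passing from modulus 2 to modulus 4 is what makes parity information about the divisor
  functions sufficient for the whole proof.
\<close>

lemma fps_cong_double:
  assumes "fps_cong N 2 f g"
  shows "fps_cong N 4 (2 * f) (2 * g)"
  unfolding fps_cong_def
proof (intro allI impI)
  fix i assume "i \<le> N"
  then have "2 dvd f $ i - g $ i"
    using assms by (simp add: fps_cong_def cong_iff_dvd_diff)
  then have "2 * 2 dvd 2 * (f $ i - g $ i)"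
    by (rule mult_dvd_mono[OF dvd_refl])
  then show "[(2 * f) $ i = (2 * g) $ i] (mod 4)"
    by (simp add: cong_iff_dvd_diff numeral_fps_const algebra_simps)
qed

abbreviation theta :: "int fps \<Rightarrow> int fps" where
  "theta f \<equiv> fps_X * fps_deriv f"

lemma theta_nth: "theta f $ n = int n * f $ n"
  by (cases n) auto

lemma theta_mult: "theta (f * g) = theta f * g + f * theta g"
  by (simp add: algebra_simps)

text \<open>The substitution of \<open>q^2\<close> for \<open>q\<close>.\<close>

definition dilate :: "int fps \<Rightarrow> int fps" where
  "dilate f = Abs_fps (\<lambda>n. if even n then f $ (n div 2) else 0)"

lemma dilate_nth: "dilate f $ n = (if even n then f $ (n div 2) else 0)"
  by (simp add: dilate_def)

lemma fps_cong_dilate: "fps_cong N m f g \<Longrightarrow> fps_cong N m (dilate f) (dilate g)"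
  unfolding fps_cong_def dilate_nth by (auto simp: le_diff_conv)

text \<open>
  An involution pairs off the points that it moves. The order of the natural numbers picks one
  representative from each pair.
\<close>

lemma sum_involution_mod_2:
  fixes a :: "nat \<Rightarrow> int"
  assumes fin: "finite A"
    and inv: "\<And>i. i \<in> A \<Longrightarrow> \<tau> i \<in> A" "\<And>i. i \<in> A \<Longrightarrow> \<tau> (\<tau> i) = i"
    and a: "\<And>i. i \<in> A \<Longrightarrow> a (\<tau> i) = a i"
  shows "[(\<Sum>i\<in>A. a i) = (\<Sum>i | i \<in> A \<and> \<tau> i = i. a i)] (mod 2)"
proof -
  let ?L = "{i \<in> A. i < \<tau> i}" and ?G = "{i \<in> A. \<tau> i < i}" and ?F = "{i \<in> A. \<tau> i = i}"
  have "sum a ?L = sum a ?G"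
    by (rule sum.reindex_bij_witness[of _ \<tau> \<tau>]) (auto simp: inv a)
  moreover have "sum a A = sum a ((?L \<union> ?G) \<union> ?F)"
    by (rule sum.cong) auto
  moreover have "\<dots> = sum a (?L \<union> ?G) + sum a ?F"
    using fin by (intro sum.union_disjoint) auto
  moreover have "sum a (?L \<union> ?G) = sum a ?L + sum a ?G"
    using fin by (intro sum.union_disjoint) auto
  ultimately have "sum a A = sum a ?F + 2 * sum a ?G"
    by simp
  then show ?thesis
    by (simp add: cong_iff_dvd_diff)
qed

text \<open>
  The Frobenius map modulo 2: in the convolution, the involution \<open>i \<mapsto> n - i\<close> leaves only the
  middle term, which is the square of a coefficient and so has the parity of that coefficient.
\<close>

lemma square_cong_dilate: "fps_cong N 2 (f * f) (dilate f)"
  unfolding fps_cong_def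
proof (intro allI impI)
  fix n
  have "[(\<Sum>i\<in>{0..n}. f $ i * f $ (n - i))
       = (\<Sum>i | i \<in> {0..n} \<and> n - i = i. f $ i * f $ (n - i))] (mod 2)"
    by (rule sum_involution_mod_2) auto
  also have "{i. i \<in> {0..n} \<and> n - i = i} = (if even n then {n div 2} else {})"
    by auto presburger
  also have "[(\<Sum>i\<in>\<dots>. f $ i * f $ (n - i)) = dilate f $ n] (mod 2)"
    by (auto simp: dilate_nth cong_iff_dvd_diff elim!: evenE)
  finally show "[(f * f) $ n = dilate f $ n] (mod 2)"
    by (simp add: fps_mult_nth)
qed


section \<open>Divisor sums and squares\<close>

text \<open>The geometric series \<open>q^j/(1 - q^j)\<close>.\<close>

definition geo :: "nat \<Rightarrow> int fps" where
  "geo j = Abs_fps (\<lambda>i. if 0 < i \<and> j dvd i then 1 else 0)"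

lemma geo_nth: "geo j $ i = (if 0 < i \<and> j dvd i then 1 else 0)"
  by (simp add: geo_def)

lemma geo_mult:
  assumes "j > 0"
  shows "(1 - fps_X ^ j) * geo j = fps_X ^ j"
proof (rule fps_ext)
  fix i
  have "geo j $ i - (if i < j then 0 else geo j $ (i - j)) = (if i = j then 1 else 0)"
    using assms by (auto simp: geo_nth dvd_minus_self dest: dvd_imp_le)
  then show "((1 - fps_X ^ j) * geo j) $ i = (fps_X ^ j :: int fps) $ i"
    by (simp add: left_diff_distrib fps_X_power_mult_nth)
qed

definition squares :: "int fps" where
  "squares = Abs_fps (\<lambda>i. if \<exists>a>0. i = a\<^sup>2 then 1 else 0)"

lemma squares_nth: "squares $ i = (if \<exists>a>0. i = a\<^sup>2 then 1 else 0)"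
  by (simp add: squares_def)

lemma sum_geo_nth:
  assumes "n \<le> N"
  shows "(\<Sum>j=1..N. of_int (c j) * geo j) $ n = (if n = 0 then 0 else \<Sum>d | d dvd n. c d)"
proof (cases "n = 0")
  case False
  have "(\<Sum>j=1..N. of_int (c j) * geo j) $ n = (\<Sum>j=1..N. if j dvd n then c j else 0)"
    using False by (auto simp: fps_sum_nth geo_nth simp flip: fps_of_int intro!: sum.cong)
  also have "\<dots> = (\<Sum>d\<in>{1..N} \<inter> {d. d dvd n}. c d)"
    by (simp add: sum.inter_restrict)
  also have "{1..N} \<inter> {d. d dvd n} = {d. d dvd n}"
    using False assms dvd_imp_le[of _ n] by (force intro: Nat.gr0I)
  finally show ?thesis
    using False by simp
qed (simp add: fps_sum_nth geo_nth flip: fps_of_int)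

text \<open>
  The involution \<open>d \<mapsto> n/d\<close> on the divisors of \<open>n\<close> has a fixed point exactly when \<open>n\<close> is a square.
\<close>

lemma divisor_count_cong_squares: "fps_cong N 2 (\<Sum>j=1..N. geo j) squares"
  unfolding fps_cong_def
proof (intro allI impI)
  fix n assume "n \<le> N"
  show "[(\<Sum>j=1..N. geo j) $ n = squares $ n] (mod 2)"
  proof (cases "n = 0")
    case True
    then show ?thesis
      by (simp add: fps_sum_nth geo_nth squares_nth)
  next
    case False
    have "(\<Sum>j=1..N. geo j) $ n = (\<Sum>d | d dvd n. 1)"
      using sum_geo_nth[OF \<open>n \<le> N\<close>, of "\<lambda>_. 1"] False by simp
    also have "[\<dots> = (\<Sum>d | d \<in> {d. d dvd n} \<and> n div d = d. 1)] (mod 2)"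
      by (rule sum_involution_mod_2) (use False in \<open>auto elim!: dvdE\<close>)
    also have "(\<Sum>d | d \<in> {d. d dvd n} \<and> n div d = d. 1) = squares $ n"
    proof (cases "\<exists>a>0. n = a\<^sup>2")
      case True
      then obtain a where a: "a > 0" "n = a\<^sup>2"
        by blast
      have "d = a" if "d dvd n" "n div d = d" for d
      proof -
        have "d\<^sup>2 = a\<^sup>2"
          using that a by (metis dvd_mult_div_cancel power2_eq_square)
        then show ?thesis
          by simp
      qed
      then have "{d. d \<in> {d. d dvd n} \<and> n div d = d} = {a}"
        using a by (auto simp: power2_eq_square)
      then show ?thesis
        using True by (simp add: squares_nth)
    next
      case no: False
      have empty: "{d. d \<in> {d. d dvd n} \<and> n div d = d} = {}"
      proof (rule ccontr)
        assume "\<not> ?thesis"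
        then obtain d where "d dvd n" "n div d = d"
          by blast
        then have "n = d\<^sup>2"
          by (metis dvd_mult_div_cancel power2_eq_square)
        then show False
          using no False by (metis gr0I power2_eq_square mult_0)
      qed
      show ?thesis
        unfolding empty using no by (simp add: squares_nth)
    qed
    finally show ?thesis .
  qed
qed

text \<open>
  Modulo 2 the sum of the divisors of \<open>n\<close> counts the odd ones. The even ones among all divisors
  correspond to the divisors of \<open>n/2\<close>, so the count is a difference of two divisor counts, and both
  are known from \<open>divisor_count_cong_squares\<close>.
\<close>

lemma sum_divisors_cong_squares:
  "fps_cong N 2 (\<Sum>j=1..N. of_nat j * geo j) (squares + dilate squares)"
proof -
  let ?G = "\<Sum>j=1..N. geo j"
  have "fps_cong N 2 (\<Sum>j=1..N. of_nat j * geo j) (?G + dilate ?G)"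
    unfolding fps_cong_def
  proof (intro allI impI)
    fix n assume n: "n \<le> N"
    show "[(\<Sum>j=1..N. of_nat j * geo j) $ n = (?G + dilate ?G) $ n] (mod 2)"
    proof (cases "n = 0")
      case True
      then show ?thesis
        by (simp add: fps_sum_nth geo_nth dilate_nth flip: fps_of_nat)
    next
      case False
      have fin: "finite {d. d dvd n}"
        using False by simp
      have G: "?G $ i = (\<Sum>d | d dvd i. 1)" if "i \<le> N" "i > 0" for i
        using sum_geo_nth[of i N "\<lambda>_. 1"] that by simp
      have "dilate ?G $ n = (\<Sum>d | d dvd n. if even d then 1 else 0)"
      proof (cases "even n")
        case True
        then obtain m where m: "n = 2 * m"
          by blast
        have "(\<Sum>d | d dvd n. if even d then 1 else 0) = (\<Sum>d | d dvd n \<and> even d. 1 :: int)"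
          using fin by (simp add: sum.inter_filter[symmetric])
        also have "\<dots> = (\<Sum>d | d dvd m. 1)"
          by (rule sum.reindex_bij_witness[of _ "\<lambda>d. 2 * d" "\<lambda>d. d div 2"])
             (auto simp: m elim!: evenE)
        also have "\<dots> = dilate ?G $ n"
          using G[of m] m n False by (simp add: dilate_nth)
        finally show ?thesis ..
      next
        case odd: False
        then have "\<not> even d" if "d dvd n" for d
          using that dvd_trans by blast
        then show ?thesis
          using odd by (auto simp: dilate_nth intro!: sum.neutral[symmetric])
      qed
      then have "(?G + dilate ?G) $ n = (\<Sum>d | d dvd n. 1 + (if even d then 1 else 0))"
        using G[OF n] False by (simp add: sum.distrib)
      moreover have "[(\<Sum>d | d dvd n. int d) = \<dots>] (mod 2)"
        by (intro cong_sum) (auto simp: cong_iff_dvd_diff)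
      moreover have "(\<Sum>j=1..N. of_nat j * geo j) $ n = (\<Sum>d | d dvd n. int d)"
        using sum_geo_nth[OF n, of int] False by simp
      ultimately show ?thesis
        by simp
    qed
  qed
  also have "fps_cong N 2 \<dots> (squares + dilate squares)"
    by (intro fps_cong_add fps_cong_dilate divisor_count_cong_squares)
  finally show ?thesis .
qed

text \<open>
  Modulo 2 the operator \<open>\<theta>\<close> deletes the even exponents, and the even squares are the numbers
  \<open>4 b^2\<close>, that is, the exponents of the twice dilated series.
\<close>

lemma theta_squares:
  "fps_cong N 2 (theta squares) (squares + dilate (dilate squares))"
  unfolding fps_cong_def
proof (intro allI impI)
  fix n
  have "dilate (dilate squares) $ n = squares $ n" if "even n"
  proof (cases "4 dvd n")
    case True
    then obtain m where m: "n = 4 * m"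
      by blast
    have "(\<exists>a>0. m = a\<^sup>2) \<longleftrightarrow> (\<exists>a>0. n = a\<^sup>2)"
    proof
      assume "\<exists>a>0. m = a\<^sup>2"
      then obtain a where "a > 0" "m = a\<^sup>2"
        by blast
      then show "\<exists>a>0. n = a\<^sup>2"
        by (intro exI[of _ "2 * a"]) (simp add: m power_mult_distrib)
    next
      assume "\<exists>a>0. n = a\<^sup>2"
      then obtain a where a: "a > 0" "n = a\<^sup>2"
        by blast
      then have "even a"
        using that by simp
      then obtain b where "a = 2 * b"
        by blast
      then show "\<exists>a>0. m = a\<^sup>2"
        using a m by (intro exI[of _ b]) (simp add: power_mult_distrib)
    qed
    then show ?thesis
      using m by (simp add: dilate_nth squares_nth)
  next
    case False
    have "\<not> (\<exists>a>0. n = a\<^sup>2)"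
    proof
      assume "\<exists>a>0. n = a\<^sup>2"
      then obtain a where a: "n = a\<^sup>2"
        by blast
      then have "even a"
        using that by simp
      then have "2 * 2 dvd a * a"
        by (intro mult_dvd_mono)
      then show False
        using False a by (simp add: power2_eq_square)
    qed
    moreover have "odd (n div 2)"
      using False \<open>even n\<close> by (auto elim!: evenE)
    ultimately show ?thesis
      using that by (simp add: dilate_nth squares_nth)
  qed
  then show "[theta squares $ n = (squares + dilate (dilate squares)) $ n] (mod 2)"
    by (cases "even n") (auto simp: theta_nth cong_iff_dvd_diff dilate_nth simp flip: left_diff_distrib elim!: oddE)
qed


section \<open>The two products\<close>

text \<open>
  The coefficients of this polynomial up to \<open>q^N\<close> are those of the infinite product.
\<close>

definition euler :: "nat \<Rightarrow> int fps" where
  "euler N = (\<Prod>j=1..N. 1 - fps_X ^ j)"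

text \<open>Logarithmic differentiation of the product, without division.\<close>

lemma theta_euler: "theta (euler N) = - (euler N * (\<Sum>j=1..N. of_nat j * geo j))"
proof (induction N)
  case (Suc N)
  let ?x = "fps_X ^ Suc N :: int fps" and ?c = "of_nat (Suc N) :: int fps"
  let ?L = "\<Sum>j=1..N. of_nat j * geo j :: int fps"
  have E: "euler (Suc N) = euler N * (1 - ?x)"
    by (simp add: euler_def)
  have "theta (1 - ?x) = - (?c * ?x)"
    by (rule fps_ext) (simp add: theta_nth flip: fps_of_nat del: of_nat_Suc power_Suc)
  also have "\<dots> = - (?c * ((1 - ?x) * geo (Suc N)))"
    by (simp only: geo_mult zero_less_Suc)
  finally have x: "theta (1 - ?x) = - (?c * ((1 - ?x) * geo (Suc N)))" .
  have "theta (euler (Suc N)) = - (euler N * ?L) * (1 - ?x) + euler N * theta (1 - ?x)"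
    by (simp only: E theta_mult Suc.IH)
  also have "\<dots> = - (euler (Suc N) * (?L + ?c * geo (Suc N)))"
    unfolding x E by (simp add: algebra_simps del: of_nat_Suc power_Suc)
  finally show ?case
    by simp
qed (simp add: euler_def)

lemma theta_euler_cong:
  "fps_cong N 2 (theta (euler N)) (euler N * (squares + dilate squares))"
proof -
  let ?L = "\<Sum>j=1..N. of_nat j * geo j :: int fps"
  have "theta (euler N) = euler N * ?L + of_int 2 * (- (euler N * ?L))"
    by (simp add: theta_euler)
  also have "fps_cong N 2 \<dots> (euler N * ?L)"
    by (rule fps_cong_add_multiple)
  also have "fps_cong N 2 \<dots> (euler N * (squares + dilate squares))"
    by (intro fps_cong_mult fps_cong_refl sum_divisors_cong_squares)
  finally show ?thesis .
qed

text \<open>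
  Expanding \<open>\<Prod>(1 + 2 q^j/(1 - q^j))\<close>, every product of two or more of the terms
  \<open>2 q^j/(1 - q^j)\<close> vanishes modulo 4.
\<close>

lemma distinct_product_cong:
  "fps_cong N 4 (\<Prod>j=1..N. 1 + fps_X ^ j) (euler N * (1 + 2 * squares))"
proof -
  have "fps_cong M 4 (\<Prod>j=1..N. 1 + fps_X ^ j) (euler N * (1 + 2 * (\<Sum>j=1..N. geo j)))" for M
  proof (induction N)
    case (Suc N)
    let ?Q = "\<Prod>j=1..N. 1 + fps_X ^ j :: int fps" and ?G = "\<Sum>j=1..N. geo j"
    let ?x = "fps_X ^ Suc N :: int fps" and ?g = "geo (Suc N)"
    have "(1 - ?x) * (1 + 2 * ?g) = (1 - ?x) + 2 * ((1 - ?x) * ?g)"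
      by (simp add: algebra_simps del: power_Suc)
    also have "\<dots> = (1 - ?x) + 2 * ?x"
      by (simp only: geo_mult zero_less_Suc)
    \<comment> \<open>The factor \<open>1 - ?x\<close> is the one by which \<open>euler (Suc N)\<close> extends \<open>euler N\<close>.\<close>
    finally have g: "1 + ?x = (1 - ?x) * (1 + 2 * ?g)"
      by simp
    have "(\<Prod>j=1..Suc N. 1 + fps_X ^ j) = ?Q * (1 + ?x)"
      by simp
    also have "fps_cong M 4 \<dots> (euler N * (1 + 2 * ?G) * (1 + ?x))"
      by (intro fps_cong_mult Suc.IH fps_cong_refl)
    also have "euler N * (1 + 2 * ?G) * (1 + ?x)
        = euler (Suc N) * (1 + 2 * (\<Sum>j=1..Suc N. geo j)) + of_int 4 * (euler (Suc N) * ?G * ?g)"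
      unfolding g by (simp add: euler_def algebra_simps del: power_Suc)
    also have "fps_cong M 4 \<dots> (euler (Suc N) * (1 + 2 * (\<Sum>j=1..Suc N. geo j)))"
      by (rule fps_cong_add_multiple)
    finally show ?case .
  qed (simp add: euler_def)
  also have "fps_cong N 4 (euler N * (1 + 2 * (\<Sum>j=1..N. geo j))) (euler N * (1 + 2 * squares))"
    by (intro fps_cong_mult fps_cong_add fps_cong_refl fps_cong_double divisor_count_cong_squares)
  finally show ?thesis .
qed

text \<open>
  With \<open>\<theta>P \<equiv> P(T + VT)\<close> and \<open>\<theta>T \<equiv> T + VT \<cdot> VT\<close> every summand becomes \<open>P\<close> times a polynomial in
  \<open>T\<close> and \<open>VT\<close>. After \<open>T^2\<close> is replaced by \<open>VT\<close>, the surviving terms form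
  \<open>P \<cdot> VT \<cdot> (T + VT)\<close>, which is \<open>VT \<cdot> \<theta>P\<close> again.
\<close>

lemma theta_euler_squares:
  "fps_cong N 2 (theta (euler N) + theta (euler N * squares)) (dilate squares * theta (euler N))"
proof -
  let ?P = "euler N" and ?T = squares and ?V = "dilate squares"
  have T: "fps_cong N 2 (theta ?T) (?T + ?V * ?V)"
    using theta_squares square_cong_dilate fps_cong_sym fps_cong_add fps_cong_refl fps_cong_trans
    by metis
  have "theta ?P + theta (?P * ?T) = theta ?P + (theta ?P * ?T + ?P * theta ?T)"
    by (simp only: theta_mult)
  also have "fps_cong N 2 \<dots> (?P * (?T + ?V) + (?P * (?T + ?V) * ?T + ?P * (?T + ?V * ?V)))"
    by (intro fps_cong_add fps_cong_mult fps_cong_refl theta_euler_cong T)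
  also have "\<dots> = ?P * (?T * ?T) + (?P * (?V + ?T * ?V + ?V * ?V) + of_int 2 * (?P * ?T))"
    by (simp add: algebra_simps)
  also have "fps_cong N 2 \<dots> (?P * ?V + ?P * (?V + ?T * ?V + ?V * ?V))"
    by (intro fps_cong_add fps_cong_mult fps_cong_refl square_cong_dilate fps_cong_add_multiple)
  also have "\<dots> = ?V * (?P * (?T + ?V)) + of_int 2 * (?P * ?V)"
    by (simp add: algebra_simps)
  also have "fps_cong N 2 \<dots> (?V * (?P * (?T + ?V)))"
    by (rule fps_cong_add_multiple)
  also have "fps_cong N 2 \<dots> (?V * theta ?P)"
    by (intro fps_cong_mult fps_cong_refl fps_cong_sym[OF theta_euler_cong])
  finally show ?thesis .
qed

lemma card_distinct_partitions:
  "int (card (distinct_partitions n)) = (\<Prod>j=1..n. 1 + fps_X ^ j) $ n"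
proof -
  have sub: "S \<subseteq> {1..n}" if "S \<in> distinct_partitions n" for S
  proof
    fix p assume "p \<in> S"
    moreover have "finite S" "0 \<notin> S" "\<Sum>S = n"
      using that by (auto simp: distinct_partitions_def)
    ultimately show "p \<in> {1..n}"
      using member_le_sum[of p S "\<lambda>x. x"] by (cases p) auto
  qed
  have "(\<Prod>j=1..n. 1 + fps_X ^ j) = (\<Prod>j=1..n. fps_X ^ j + 1 :: int fps)"
    by (simp add: add.commute)
  also have "\<dots> = (\<Sum>S\<in>Pow {1..n}. fps_X ^ (\<Sum>S))"
    by (subst prod_add) (simp_all flip: power_sum)
  finally have "(\<Prod>j=1..n. 1 + fps_X ^ j :: int fps) $ n
      = (\<Sum>S\<in>Pow {1..n}. if n = \<Sum>S then 1 else 0)"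
    by (simp add: fps_sum_nth)
  also have "\<dots> = int (card {S \<in> Pow {1..n}. n = \<Sum>S})"
    by (simp flip: sum.inter_filter)
  also have "{S \<in> Pow {1..n}. n = \<Sum>S} = distinct_partitions n"
    using sub by (auto simp: distinct_partitions_def intro: finite_subset)
  finally show ?thesis ..
qed

text \<open>
  The two signs agree modulo 4, because they differ by \<open>2p\<close> for an even part \<open>p\<close>. So every
  partition contributes the sum of its parts.
\<close>

lemma DSOME_cong_card: "[DSOME n = int n * int (card (distinct_partitions n))] (mod 4)"
proof -
  have "[(\<Sum>p | p \<in> S \<and> odd p. int p) - (\<Sum>p | p \<in> S \<and> even p. int p) = int n] (mod 4)"
    if "S \<in> distinct_partitions n" for S
  proof -
    have fin: "finite S" and S: "\<Sum>S = n"
      using that by (auto simp: distinct_partitions_def)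
    have "int n = (\<Sum>p | p \<in> S \<and> odd p. int p) + (\<Sum>p | p \<in> S \<and> even p. int p)"
      using fin by (subst sum.union_disjoint[symmetric])
        (auto simp: S[symmetric] intro!: sum.cong)
    moreover have "2 dvd (\<Sum>p | p \<in> S \<and> even p. int p)"
      by (rule dvd_sum) auto
    ultimately show ?thesis
      by (auto simp: cong_iff_dvd_diff elim!: dvdE)
  qed
  then have "[(\<Sum>S\<in>distinct_partitions n.
      (\<Sum>p | p \<in> S \<and> odd p. int p) - (\<Sum>p | p \<in> S \<and> even p. int p))
      = (\<Sum>S\<in>distinct_partitions n. int n)] (mod 4)"
    by (rule cong_sum)
  then show ?thesis
    by (simp add: DSOME_def sum_subtractf mult.commute)
qed

lemma DSOME_cong_theta:
  "[DSOME n = 2 * (dilate squares * theta (euler n)) $ n - int n * euler n $ n] (mod 4)"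
proof -
  let ?P = "euler n" and ?T = squares
  have "[DSOME n = int n * (\<Prod>j=1..n. 1 + fps_X ^ j) $ n] (mod 4)"
    using DSOME_cong_card[of n] by (simp only: card_distinct_partitions)
  also have "[int n * (\<Prod>j=1..n. 1 + fps_X ^ j) $ n = int n * (?P * (1 + 2 * ?T)) $ n] (mod 4)"
    using distinct_product_cong[of n] by (intro cong_scalar_left) (simp add: fps_cong_def)
  also have "int n * (?P * (1 + 2 * ?T)) $ n
      = (2 * (theta ?P + theta (?P * ?T))) $ n - int n * ?P $ n"
  proof -
    have "?P * (1 + 2 * ?T) = ?P + fps_const 2 * (?P * ?T)"
      by (simp add: algebra_simps numeral_fps_const)
    then show ?thesis
      unfolding numeral_fps_const
      by (simp only: theta_nth fps_add_nth fps_mult_left_const_nth) (simp add: algebra_simps)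
  qed
  also have "[\<dots> = (2 * (dilate squares * theta ?P)) $ n - int n * ?P $ n] (mod 4)"
    using fps_cong_double[OF theta_euler_squares[of n]]
    by (intro cong_diff cong_refl) (simp add: fps_cong_def)
  finally show ?thesis
    by (simp add: numeral_fps_const)
qed


section \<open>Euler's pentagonal number theorem\<close>

text \<open>
  The proof is Shanks's finite form of the theorem. The sum over \<open>s \<le> n\<close> of \<open>shanks_term n s\<close>
  starts with \<open>euler n\<close>, and its other terms are divisible by \<open>q^(n+1)\<close>, so they do not affect the
  coefficients up to \<open>n\<close>. On the other hand the sum equals the partial sum of the pentagonal
  series, by a telescoping argument.
\<close>

definition euler_tail :: "nat \<Rightarrow> nat \<Rightarrow> int fps" where
  "euler_tail s n = (\<Prod>j=Suc s..n. 1 - fps_X ^ j)"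

definition shanks_term :: "nat \<Rightarrow> nat \<Rightarrow> int fps" where
  "shanks_term n s = (- 1) ^ s * euler_tail s n * fps_X ^ (s * n + \<Sum>{..s})"

definition pentagonal_sum :: "nat \<Rightarrow> int fps" where
  "pentagonal_sum n = (\<Sum>k=-int n..int n. (- 1) ^ nat \<bar>k\<bar> * fps_X ^ nat (pentagonal k))"

lemma euler_tail_Suc_right:
  "s \<le> n \<Longrightarrow> euler_tail s (Suc n) = euler_tail s n * (1 - fps_X ^ Suc n)"
  by (simp add: euler_tail_def del: power_Suc)

lemma euler_tail_Suc_left:
  "s < n \<Longrightarrow> euler_tail s n = (1 - fps_X ^ Suc s) * euler_tail (Suc s) n"
  by (simp add: euler_tail_def prod.atLeast_Suc_atMost del: power_Suc)

text \<open>
  Writing \<open>U m\<close> for the negative of the right-hand side, the summand with index \<open>s > 0\<close> is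
  \<open>U (s - 1) - U s\<close>: the factor \<open>1 - q^(n+1)\<close> by which the tails for \<open>n + 1\<close> and \<open>n\<close> differ yields
  \<open>U s\<close>, and the factor \<open>1 - q^s\<close> coming from the exponents extends the tail by one factor and
  yields \<open>U (s - 1)\<close>.
\<close>

lemma shanks_telescope:
  assumes "m \<le> n"
  shows "(\<Sum>s\<le>m. shanks_term (Suc n) s - shanks_term n s)
       = - ((- 1) ^ m * euler_tail m n * fps_X ^ (Suc m * n + \<Sum>{..Suc m}))"
  using assms
proof (induction m)
  case 0
  then show ?case
    by (simp add: shanks_term_def euler_tail_Suc_right algebra_simps)
next
  case (Suc m)
  define Y where "Y = (fps_X ^ (Suc m * n + \<Sum>{..Suc m}) :: int fps)"
  define a where "a = (fps_X ^ Suc m :: int fps)"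
  define b where "b = (fps_X ^ Suc n :: int fps)"
  have Y1: "fps_X ^ (Suc m * Suc n + \<Sum>{..Suc m}) = Y * a"
    unfolding Y_def a_def power_add[symmetric] by (rule arg_cong[where f = "power fps_X"]) simp
  have Y2: "fps_X ^ (Suc (Suc m) * n + \<Sum>{..Suc (Suc m)}) = Y * a * b"
    unfolding Y_def a_def b_def power_add[symmetric]
    by (rule arg_cong[where f = "power fps_X"]) simp
  have "shanks_term (Suc n) (Suc m) = (- 1) ^ Suc m * (euler_tail (Suc m) n * (1 - b)) * (Y * a)"
    using Suc.prems by (simp only: shanks_term_def euler_tail_Suc_right Y1 b_def)
  moreover have "shanks_term n (Suc m) = (- 1) ^ Suc m * euler_tail (Suc m) n * Y"
    by (simp only: shanks_term_def Y_def)
  moreover have "(\<Sum>s\<le>m. shanks_term (Suc n) s - shanks_term n s)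
      = - ((- 1) ^ m * ((1 - a) * euler_tail (Suc m) n) * Y)"
    using Suc.IH Suc.prems by (simp only: a_def Y_def euler_tail_Suc_left Suc_le_lessD Suc_leD)
  ultimately show ?case
    unfolding Y2 unfolding sum.atMost_Suc by (simp add: algebra_simps)
qed

text \<open>
  In the step from \<open>n\<close> to \<open>n + 1\<close> the telescoped sum supplies the new pentagonal exponent of index
  \<open>n + 1\<close>, and the additional last term that of index \<open>-(n + 1)\<close>.
\<close>

lemma shanks_identity: "(\<Sum>s\<le>n. shanks_term n s) = pentagonal_sum n"
proof (induction n)
  case 0
  show ?case
    by (simp add: shanks_term_def pentagonal_sum_def euler_tail_def pentagonal_def)
next
  case (Suc n)
  have nat_eq: "nat b = a" if "2 * int a = 2 * b" for a b
    using that by simp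
  have tri: "2 * int (\<Sum>{..s}) = int s * (int s + 1)" for s
    by (induction s) (auto simp: algebra_simps)
  have "2 * int (Suc n * n + \<Sum>{..Suc n}) = 2 * pentagonal (int (Suc n))"
    using tri[of "Suc n"] unfolding two_times_pentagonal by (simp add: algebra_simps del: of_nat_sum sum.atMost_Suc)
  then have p: "nat (pentagonal (int (Suc n))) = Suc n * n + \<Sum>{..Suc n}"
    by (rule nat_eq)
  have "2 * int (Suc n * Suc n + \<Sum>{..Suc n}) = 2 * pentagonal (- int (Suc n))"
    using tri[of "Suc n"] unfolding two_times_pentagonal by (simp add: algebra_simps del: of_nat_sum sum.atMost_Suc)
  then have m: "nat (pentagonal (- int (Suc n))) = Suc n * Suc n + \<Sum>{..Suc n}"
    by (rule nat_eq)
  have "{- int (Suc n)..int (Suc n)} = insert (int (Suc n)) (insert (- int (Suc n)) {- int n..int n})"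
    by auto
  then have "pentagonal_sum (Suc n) = (- 1) ^ Suc n * fps_X ^ (Suc n * n + \<Sum>{..Suc n})
      + ((- 1) ^ Suc n * fps_X ^ (Suc n * Suc n + \<Sum>{..Suc n}) + pentagonal_sum n)"
    unfolding pentagonal_sum_def
    by (simp add: p m nat_add_distrib del: mult_Suc mult_Suc_right sum.atMost_Suc of_nat_Suc)
  moreover have "(\<Sum>s\<le>n. shanks_term (Suc n) s)
      = pentagonal_sum n - (- 1) ^ n * fps_X ^ (Suc n * n + \<Sum>{..Suc n})"
    using shanks_telescope[of n n] Suc.IH
    by (simp add: sum_subtractf euler_tail_def algebra_simps del: mult_Suc mult_Suc_right sum.atMost_Suc)
  ultimately show ?case
    by (simp add: shanks_term_def[of "Suc n" "Suc n"] euler_tail_def del: mult_Suc mult_Suc_right)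
qed

lemma euler_nth_pentagonal_sum:
  assumes "i \<le> n"
  shows "euler n $ i = pentagonal_sum n $ i"
proof -
  have "shanks_term n s $ i = 0" if "s \<in> {..n} - {0}" for s
  proof -
    have "s * n \<ge> n" "\<Sum>{..s} \<ge> 1"
      using that by (cases s; simp)+
    then have "i < s * n + \<Sum>{..s}"
      using assms by linarith
    then show ?thesis
      by (simp add: shanks_term_def fps_X_power_mult_right_nth)
  qed
  then have "(\<Sum>s\<le>n. shanks_term n s $ i) = shanks_term n 0 $ i"
    by (intro sum.mono_neutral_right[of "{..n}" "{0}", simplified]) auto
  then show ?thesis
    by (simp add: shanks_identity[symmetric] fps_sum_nth shanks_term_def euler_tail_def euler_def)
qed

lemma pentagonal_inj:
  assumes "pentagonal k = pentagonal l"
  shows "k = l"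
proof -
  have "k * (3 * k - 1) = l * (3 * l - 1)"
    using assms by (simp flip: two_times_pentagonal)
  then have "(k - l) * (3 * (k + l) - 1) = 0"
    by (simp add: algebra_simps)
  \<comment> \<open>The second factor is \<open>-1\<close> modulo 3.\<close>
  moreover have "3 * (k + l) - 1 \<noteq> 0"
    by presburger
  ultimately show ?thesis
    by simp
qed

lemma abs_le_pentagonal: "\<bar>k\<bar> \<le> pentagonal k"
proof (cases "k > 0")
  case True
  then have "k * 2 \<le> k * (3 * k - 1)"
    by (intro mult_left_mono) auto
  then show ?thesis
    using True two_times_pentagonal[of k] by linarith
next
  case False
  show ?thesis
  proof (cases "k = 0")
    case True
    then show ?thesis
      by (simp add: pentagonal_def)
  next
    case nz: False
    then have "(- k) * 2 \<le> (- k) * (1 - 3 * k)"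
      using False by (intro mult_left_mono) auto
    then show ?thesis
      using False two_times_pentagonal[of k] by (simp add: algebra_simps)
  qed
qed

text \<open>
  The index set has at most one element, so the sum is the coefficient of the pentagonal series.
\<close>

lemma euler_nth:
  assumes "i \<le> n"
  shows "euler n $ i = (\<Sum>k | int i = pentagonal k. (- 1) ^ nat \<bar>k\<bar>)"
proof -
  have sgn: "(- 1) ^ m = fps_const ((- 1) ^ m :: int)" for m
    by (simp add: fps_const_power[symmetric] flip: fps_const_neg)
  have i: "i = nat (pentagonal k) \<longleftrightarrow> int i = pentagonal k" for k
    using abs_le_pentagonal[of k] by linarith
  have "euler n $ i = (\<Sum>k=-int n..int n. if int i = pentagonal k then (- 1) ^ nat \<bar>k\<bar> else 0)"
    unfolding euler_nth_pentagonal_sum[OF assms] pentagonal_sum_def fps_sum_nth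
    by (intro sum.cong) (simp_all add: sgn i)
  also have "\<dots> = (\<Sum>k | k \<in> {-int n..int n} \<and> int i = pentagonal k. (- 1) ^ nat \<bar>k\<bar>)"
    by (subst sum.inter_filter[symmetric]) simp_all
  also have "{k. k \<in> {-int n..int n} \<and> int i = pentagonal k} = {k. int i = pentagonal k}"
  proof -
    have "k \<in> {-int n..int n}" if "int i = pentagonal k" for k
      using abs_le_pentagonal[of k] that assms by (simp add: abs_le_iff)
    then show ?thesis
      by blast
  qed
  finally show ?thesis .
qed

lemma euler_nth_pentagonal:
  assumes "i \<le> n" "int i = pentagonal k"
  shows "euler n $ i = (- 1) ^ nat \<bar>k\<bar>"
proof -
  have "{l. int i = pentagonal l} = {k}"
    using assms(2) pentagonal_inj by auto
  then show ?thesis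
    by (simp add: euler_nth[OF assms(1)])
qed

lemma euler_nth_not_pentagonal:
  assumes "i \<le> n" "\<forall>k. int i \<noteq> pentagonal k"
  shows "euler n $ i = 0"
  using assms by (simp add: euler_nth)


section \<open>The correction term\<close>

lemma pentagonal_residues:
  "pentagonal (4 * j + 1) = 24 * j\<^sup>2 + 10 * j + 1"
  "pentagonal (4 * j + 2) = 24 * j\<^sup>2 + 22 * j + 5"
  "pentagonal (4 * j + 3) = 24 * j\<^sup>2 + 34 * j + 12"
  "pentagonal (4 * j) = 24 * j\<^sup>2 - 2 * j"
  using two_times_pentagonal[of "4 * j + 1"] two_times_pentagonal[of "4 * j + 2"]
    two_times_pentagonal[of "4 * j + 3"] two_times_pentagonal[of "4 * j"]
  by (simp_all add: algebra_simps power2_eq_square)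

lemma odd_pentagonal_iff:
  "odd (pentagonal k) \<longleftrightarrow> (\<exists>j. k = 4 * j + 1 \<or> k = 4 * j + 2)"
proof -
  obtain j where "k = 4 * j \<or> k = 4 * j + 1 \<or> k = 4 * j + 2 \<or> k = 4 * j + 3"
    by (rule that[of "k div 4"]) presburger
  then show ?thesis
    by (elim disjE; simp add: pentagonal_residues; presburger)
qed

lemma rho_eq_card:
  "rho n = card {(a, k). a > 0 \<and> int n = 2 * a\<^sup>2 + pentagonal k \<and> odd (pentagonal k)}"
    (is "_ = card ?K")
proof -
  let ?f = "\<lambda>(a :: int, j :: int). (a, 4 * j + 1)" and ?g = "\<lambda>(a :: int, j :: int). (a, 4 * j + 2)"
  have "?K = ?f ` rho_set1 n \<union> ?g ` rho_set2 n"
    by (auto simp: rho_set1_def rho_set2_def odd_pentagonal_iff pentagonal_residues image_iff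
        add.assoc)
  moreover have "?f ` rho_set1 n \<inter> ?g ` rho_set2 n = {}"
    by (auto; presburger)
  moreover have "inj_on ?f (rho_set1 n)" "inj_on ?g (rho_set2 n)"
    by (auto simp: inj_on_def)
  ultimately show ?thesis
    by (simp add: rho_def card_Un_disjoint card_image finite_rho_set1 finite_rho_set2)
qed

lemma dilate_squares_nth: "dilate squares $ i = (if \<exists>a>0. i = 2 * a\<^sup>2 then 1 else 0)"
  by (auto simp: dilate_nth squares_nth) (metis less_irrefl)

text \<open>
  The operator \<open>\<theta>\<close> keeps the odd pentagonal exponents modulo 2, so the convolution counts the
  \<open>i\<close> for which \<open>i\<close> is twice a positive square and \<open>n - i\<close> is an odd pentagonal number. Such an
  \<open>i\<close> determines the square root and the pentagonal index.
\<close>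

lemma correction_cong_rho:
  "[(dilate squares * theta (euler n)) $ n = int (rho n)] (mod 2)"
proof -
  let ?K = "{(a, k). a > 0 \<and> int n = 2 * a\<^sup>2 + pentagonal k \<and> odd (pentagonal k)}"
  let ?I = "{i. i \<in> {0..n} \<and> (\<exists>a>0. i = 2 * a\<^sup>2) \<and> odd (n - i) \<and> (\<exists>k. int (n - i) = pentagonal k)}"
  have theta_nth_mod_2: "[theta (euler n) $ m
      = (if odd m \<and> (\<exists>k. int m = pentagonal k) then 1 else 0)] (mod 2)" if "m \<le> n" for m
  proof (cases "\<exists>k. int m = pentagonal k")
    case True
    then obtain k where "int m = pentagonal k"
      by blast
    then have "euler n $ m = (- 1) ^ nat \<bar>k\<bar>"
      using that by (rule euler_nth_pentagonal[rotated])
    then show ?thesis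
      using True by (auto simp: theta_nth cong_iff_dvd_diff)
  next
    case False
    then have "euler n $ m = 0"
      using that by (intro euler_nth_not_pentagonal) auto
    then show ?thesis
      using False by (auto simp: theta_nth)
  qed
  have "[(dilate squares * theta (euler n)) $ n
      = (\<Sum>i\<in>{0..n}. dilate squares $ i *
          (if odd (n - i) \<and> (\<exists>k. int (n - i) = pentagonal k) then 1 else 0))] (mod 2)"
    unfolding fps_mult_nth[of "dilate squares"]
    by (intro cong_sum cong_scalar_left theta_nth_mod_2 diff_le_self)
  also have "(\<Sum>i\<in>{0..n}. dilate squares $ i *
          (if odd (n - i) \<and> (\<exists>k. int (n - i) = pentagonal k) then 1 else 0))
      = (\<Sum>i\<in>{0..n}. if (\<exists>a>0. i = 2 * a\<^sup>2) \<and> odd (n - i) \<and> (\<exists>k. int (n - i) = pentagonal k) then 1 else 0)"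
    by (intro sum.cong refl) (simp add: dilate_squares_nth)
  also have "\<dots> = int (card ?I)"
    by (simp only: sum.inter_filter[symmetric] finite_atLeastAtMost) simp
  also have "card ?I = card ?K"
  proof (rule bij_betw_same_card[symmetric], unfold bij_betw_def, intro conjI)
    show "inj_on (\<lambda>(a, k). nat (2 * a\<^sup>2)) ?K"
    proof (rule inj_onI, clarify)
      fix a k b l :: int
      assume *: "0 < a" "int n = 2 * a\<^sup>2 + pentagonal k" "0 < b" "int n = 2 * b\<^sup>2 + pentagonal l"
        and same: "nat (2 * a\<^sup>2) = nat (2 * b\<^sup>2)"
      have "2 * a\<^sup>2 = 2 * b\<^sup>2"
        using same by (rule eq_nat_nat_iff[THEN iffD1, rotated 2]) simp_all
      then have sq: "a\<^sup>2 = b\<^sup>2"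
        by simp
      then have "a = b"
        using * by (simp add: power2_eq_iff)
      moreover have "k = l"
        using *(2,4) sq by (metis add_left_cancel pentagonal_inj)
      ultimately show "a = b \<and> k = l" ..
    qed
    show "(\<lambda>(a, k). nat (2 * a\<^sup>2)) ` ?K = ?I"
    proof (intro equalityI subsetI)
      fix i assume "i \<in> (\<lambda>(a, k). nat (2 * a\<^sup>2)) ` ?K"
      then obtain a k where a: "a > 0" "int n = 2 * a\<^sup>2 + pentagonal k" "odd (pentagonal k)"
        and i: "i = nat (2 * a\<^sup>2)"
        by auto
      have i2: "int i = 2 * a\<^sup>2" "i = 2 * (nat a)\<^sup>2"
        using a(1) by (simp_all add: i nat_mult_distrib nat_power_eq)
      then have "i \<le> n" "int (n - i) = pentagonal k"
        using a abs_le_pentagonal[of k] by linarith+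
      moreover have "odd (n - i)"
        using a(3) calculation(2) by (metis even_of_nat)
      ultimately show "i \<in> ?I"
        using i2(2) a(1) by (auto intro!: exI[of _ "nat a"])
    next
      fix i assume "i \<in> ?I"
      then obtain a k where *: "i \<le> n" "a > 0" "i = 2 * a\<^sup>2" "odd (n - i)" "int (n - i) = pentagonal k"
        unfolding mem_Collect_eq atLeastAtMost_iff by blast
      have "odd (pentagonal k)"
        using *(4,5) by (metis even_of_nat)
      then have "(int a, k) \<in> ?K"
        using * by (auto simp: of_nat_diff algebra_simps)
      moreover have "i = nat (2 * (int a)\<^sup>2)"
        by (simp add: *(3) nat_mult_distrib nat_power_eq)
      ultimately show "i \<in> (\<lambda>(a, k). nat (2 * a\<^sup>2)) ` ?K"
        by (intro image_eqI[of _ _ "(int a, k)"]) auto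
    qed
  qed
  finally show ?thesis
    by (simp only: rho_eq_card)
qed

lemma DSOME_cong_rho: "[DSOME n = 2 * int (rho n) - int n * euler n $ n] (mod 4)"
proof -
  have "[2 * (dilate squares * theta (euler n)) $ n = 2 * int (rho n)] (mod (2 * 2))"
    using correction_cong_rho[of n]
    by (simp only: cong_iff_dvd_diff right_diff_distrib[symmetric] dvd_mult_cancel_left) simp
  then show ?thesis
    by (intro cong_trans[OF DSOME_cong_theta] cong_diff cong_refl) simp
qed

theorem theorem4p9:
  fixes n :: nat
  shows "((\<exists>k. int n = pentagonal k) \<longrightarrow> (\<exists>!k. int n = pentagonal k))
    \<and> (\<forall>k. int n = pentagonal k \<longrightarrow>
          [DSOME n = 2 * int (rho n) - (- 1) ^ nat \<bar>k\<bar> * int n] (mod 4))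
    \<and> ((\<forall>k. int n \<noteq> pentagonal k) \<longrightarrow> [DSOME n = 2 * int (rho n)] (mod 4))"
proof (intro conjI impI allI)
  assume "\<exists>k. int n = pentagonal k"
  then show "\<exists>!k. int n = pentagonal k"
    by (metis pentagonal_inj)
next
  fix k assume "int n = pentagonal k"
  then show "[DSOME n = 2 * int (rho n) - (- 1) ^ nat \<bar>k\<bar> * int n] (mod 4)"
    using DSOME_cong_rho[of n] euler_nth_pentagonal[of n n k] by (simp add: mult.commute)
next
  assume "\<forall>k. int n \<noteq> pentagonal k"
  then show "[DSOME n = 2 * int (rho n)] (mod 4)"
    using DSOME_cong_rho[of n] euler_nth_not_pentagonal[of n n] by simp
qed

end
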